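(* Let $X\in\mathbb{R}^{n\times d}$, $Y\in\mathbb{R}^{m\times d}$, let $\sigma:\mathbb{R}\to\mathbb{R}$ be twice differentiable, and let $$F(W_1,W_0)=\tfrac12\|Y-W_1\sigma(W_0X)\|_F^2,\qquad W_1\in\mathbb{R}^{m\times r},\ W_0\in\mathbb{R}^{r\times n}.$$ Suppose there exist $W_1,W_0$ such that $Y=W_1\sigma(W_0X)$, and suppose further that $W_1$ and $\sigma(W_0X)\in\mathbb{R}^{r\times d}$ are full rank. Then the nullspace of the Hessian $\nabla^2F(W_1,W_0)$ is characterized as follows: a direction $(\widehat{W_1},\widehat{W_0})\in\mathbb{R}^{m\times r}\times\mathbb{R}^{r\times n}$ lies in it if and only if $$\Big[\widehat{W_1}\sigma(W_0X)+W_1\big(\sigma'(W_0X)\circ\widehat{W_0}X\big)\Big]\perp\sigma(W_0X)^T$$ and $$\Big[\big[\sigma'(W_0X)\circ\big(W_1^T\widehat{W_1}\sigma(W_0X)\big)\big]+\big[\sigma(W_0X)\circ\big(W_1^TW_1(\sigma'(W_0X)\circ\widehat{W_0}X)\big)\big]\Big]\perp X^T.$$ In particular, for any direction $\widehat{W_0}$ such that the directional derivative $\sigma'(W_0X)\circ\widehat{W_0}X$ is zero, the weight matrices $\widehat{W_0}$ and $$\widehat{W_1}=-W_1\big(\sigma'(W_0X)\circ\widehat{W_0}X\big)\sigma(W_0X)^T\big[\sigma(W_0X)\sigma(W_0X)^T\big]^{-1}$$ are in the nullspace of the Hessian $\nabla^2F(W_1,W_0)$.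
   Context: The function $\sigma$ and its derivative $\sigma'$ are applied to matrices elementwise. $\circ$ is the Hadamard (elementwise) product; $A\circ BC$ means $A\circ(BC)$. $\|\cdot\|_F$ is the Frobenius norm. For $A\in\mathbb{R}^{p\times q}$ and $B\in\mathbb{R}^{q\times k}$, $A\perp B$ means that the rows of $A$ are orthogonal to the columns of $B$, i.e. $AB=0$. Full rank of $\sigma(W_0X)$ is understood so that the $r\times r$ matrix $\sigma(W_0X)\sigma(W_0X)^T$ is invertible. The Hessian $\nabla^2F$ is that of $F$ as a function of the vector of all entries of $(W_1,W_0)$, and directions $(\widehat{W_1},\widehat{W_0})$ are identified with vectors accordingly.
   Formalization: In the second orthogonality condition the left factor σ(W0X) of the second Hadamard product is corrected to σ'(W0X); as printed the characterization fails, e.g. for 1×1 matrices with σ the identity, X=W1=1, W0=Y=2 and direction (1,-2). *)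

theory Defs
  imports "HOL-Analysis.Analysis"
begin

text \<open>
  The type \<^typ>\<open>real^'q^'p\<close> is that of matrices with rows indexed by \<^typ>\<open>'p\<close> and columns
  indexed by \<^typ>\<open>'q\<close>. A real function acts elementwise through \<^const>\<open>map_matrix\<close>.
\<close>

definition hadamard :: "real^'q^'p \<Rightarrow> real^'q^'p \<Rightarrow> real^'q^'p"  (infixl "\<circ>\<^sub>H" 75)
  where "A \<circ>\<^sub>H B = (\<chi> i j. A $ i $ j * B $ i $ j)"

definition rows_perp_cols :: "real^'q^'p \<Rightarrow> real^'k^'q \<Rightarrow> bool"  (infix "\<bottom>\<^sub>M" 50)
  where "A \<bottom>\<^sub>M B \<longleftrightarrow> (\<forall>i j. orthogonal (row i A) (column j B))"

lemma rows_perp_cols_iff: "A \<bottom>\<^sub>M B \<longleftrightarrow> A ** B = 0"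
  by (simp add: rows_perp_cols_def orthogonal_def row_def column_def
      matrix_matrix_mult_def vec_eq_iff inner_vec_def)

definition full_rank :: "real^'q^'p \<Rightarrow> bool"
  where "full_rank (A :: real^'q^'p) \<longleftrightarrow> rank A = min CARD('p) CARD('q)"

text \<open>The library norm on matrices is the Frobenius norm.\<close>

lemma norm_matrix_frobenius:
  fixes A :: "real^'q^'p"
  shows "norm A = sqrt (\<Sum>i\<in>UNIV. \<Sum>j\<in>UNIV. (A $ i $ j)\<^sup>2)"
  by (simp add: norm_vec_def L2_set_def sum_nonneg)

definition loss :: "(real \<Rightarrow> real) \<Rightarrow> real^'d^'n \<Rightarrow> real^'d^'m \<Rightarrow> real^'r^'m \<Rightarrow> real^'n^'r \<Rightarrow> real"
  where "loss \<sigma> X Y W1 W0 = 1/2 * (norm (Y - W1 ** map_matrix \<sigma> (W0 ** X)))\<^sup>2"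

text \<open>
  A pair of weight matrices is identified with the vector of all its entries: the coordinates
  \<^term>\<open>Inl (i, k)\<close> hold the first matrix and the coordinates \<^term>\<open>Inr (k, l)\<close> the second.
\<close>

definition vec_of_weights :: "real^'r^'m \<Rightarrow> real^'n^'r \<Rightarrow> real^(('m::finite \<times> 'r::finite) + ('r \<times> 'n::finite))"
  where "vec_of_weights W1 W0 =
    (\<chi> c. case c of Inl (i, k) \<Rightarrow> W1 $ i $ k | Inr (k, l) \<Rightarrow> W0 $ k $ l)"

definition weight1 :: "real^(('m::finite \<times> 'r::finite) + ('r \<times> 'n::finite)) \<Rightarrow> real^'r^'m"
  where "weight1 v = (\<chi> i k. v $ Inl (i, k))"

definition weight0 :: "real^(('m::finite \<times> 'r::finite) + ('r \<times> 'n::finite)) \<Rightarrow> real^'n^'r"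
  where "weight0 v = (\<chi> k l. v $ Inr (k, l))"

lemma weight_vec_of_weights [simp]:
  "weight1 (vec_of_weights W1 W0) = W1" "weight0 (vec_of_weights W1 W0) = W0"
  by (simp_all add: weight1_def weight0_def vec_of_weights_def)

lemma vec_of_weights_weight [simp]: "vec_of_weights (weight1 v) (weight0 v) = v"
  by (simp add: vec_eq_iff weight1_def weight0_def vec_of_weights_def split: sum.split)

definition loss_vec ::
    "(real \<Rightarrow> real) \<Rightarrow> real^'d^'n \<Rightarrow> real^'d^'m \<Rightarrow> real^(('m::finite \<times> 'r::finite) + ('r \<times> 'n::finite)) \<Rightarrow> real"
  where "loss_vec \<sigma> X Y v = loss \<sigma> X Y (weight1 v) (weight0 v)"

definition gradient :: "(real^'c \<Rightarrow> real) \<Rightarrow> real^'c \<Rightarrow> real^'c"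
  where "gradient f x = (\<chi> i. frechet_derivative f (at x) (axis i 1))"

text \<open>Entry \<open>(i, j)\<close> is the \<open>j\<close>-th partial derivative of the \<open>i\<close>-th partial derivative.\<close>

definition hessian :: "(real^'c \<Rightarrow> real) \<Rightarrow> real^'c \<Rightarrow> real^'c^'c"
  where "hessian f x = jacobian (gradient f) (at x)"

definition nullspace :: "real^'q^'p \<Rightarrow> (real^'q) set"
  where "nullspace A = {v. A *v v = 0}"

text \<open>
  In the second orthogonality condition, the one against \<open>X\<^sup>T\<close>, both Hadamard products have the left factor \<open>\<sigma>'(W\<^sub>0X)\<close>. It comes from the gradient
  of the loss with respect to \<open>W\<^sub>0\<close>, which is \<open>-(\<sigma>'(W\<^sub>0X) \<circ> W\<^sub>1\<^sup>TR) X\<^sup>T\<close> with \<open>R = Y - W\<^sub>1\<sigma>(W\<^sub>0X)\<close>. With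
  \<open>\<sigma>(W\<^sub>0X)\<close> as the left factor of the second product, the characterization of the nullspace
  is false: with all matrices \<open>1 \<times> 1\<close>, \<open>\<sigma>\<close> the identity, \<open>X = W\<^sub>1 = 1\<close> and \<open>Y = W\<^sub>0 = 2\<close>, the
  nullspace is spanned by \<open>(1, -2)\<close>, which would violate it.
\<close>

end

theory Submission
  imports Defs
begin

text \<open>
  With \<open>R = Y - W\<^sub>1\<sigma>(W\<^sub>0X)\<close>, the gradient of the loss is
  \<open>(-R\<sigma>(W\<^sub>0X)\<^sup>T, -(\<sigma>'(W\<^sub>0X) \<circ> W\<^sub>1\<^sup>TR)X\<^sup>T)\<close> at every pair of weights. At a pair
  with \<open>R = 0\<close> the product rule leaves only the terms in which \<open>R\<close> is differentiated, so
  no derivative of \<open>\<sigma>'\<close> survives, and the Hessian applied to a direction is the gradient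
  with \<open>-R\<close> replaced by its directional derivative
  \<open>D = V\<^sub>1\<sigma>(W\<^sub>0X) + W\<^sub>1(\<sigma>'(W\<^sub>0X) \<circ> V\<^sub>0X)\<close>.
\<close>

text \<open>In finite dimension bilinearity implies boundedness, and
  \<open>bounded_bilinear.FDERIV\<close> then yields the product rule. The same route serves the
  Hadamard product.\<close>

lemma bounded_bilinear_matrix_matrix_mult:
  "bounded_bilinear (\<lambda>(A::real^'q^'p) (B::real^'k^'q). A ** B)"
  unfolding bilinear_conv_bounded_bilinear[symmetric] bilinear_def
  by (auto intro!: linearI simp: matrix_matrix_mult_def vec_eq_iff sum.distrib sum_distrib_left algebra_simps)

lemma bounded_bilinear_hadamard:
  "bounded_bilinear (\<lambda>(A::real^'q^'p) B. A \<circ>\<^sub>H B)"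
  unfolding bilinear_conv_bounded_bilinear[symmetric] bilinear_def
  by (auto intro!: linearI simp: hadamard_def vec_eq_iff algebra_simps)

lemmas has_derivative_matrix_matrix_mult [derivative_intros] =
  bounded_bilinear.FDERIV[OF bounded_bilinear_matrix_matrix_mult]
lemmas has_derivative_hadamard [derivative_intros] =
  bounded_bilinear.FDERIV[OF bounded_bilinear_hadamard]

lemma bounded_linear_transpose: "bounded_linear (transpose :: real^'q^'p \<Rightarrow> real^'p^'q)"
  unfolding linear_conv_bounded_linear[symmetric]
  by (rule linearI) (simp_all add: transpose_def vec_eq_iff)

lemmas has_derivative_transpose [derivative_intros] =
  bounded_linear.has_derivative[OF bounded_linear_transpose]

text \<open>The adjoint of right multiplication by \<open>C\<close> for the Frobenius inner product.
  The adjoint rules strip a direction of its factors, so that a gradient can be read off a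
  directional derivative.\<close>

lemma inner_matrix_mult_left:
  "inner (A::real^'k^'p) (B ** C) = inner (A ** transpose C) (B::real^'q^'p)"
proof -
  have "inner A (B ** C) = (\<Sum>i\<in>UNIV. \<Sum>j\<in>UNIV. \<Sum>k\<in>UNIV. A $ i $ j * (B $ i $ k * C $ k $ j))"
    by (simp add: inner_vec_def matrix_matrix_mult_def sum_distrib_left)
  also have "\<dots> = (\<Sum>i\<in>UNIV. \<Sum>k\<in>UNIV. \<Sum>j\<in>UNIV. A $ i $ j * (B $ i $ k * C $ k $ j))"
    by (intro sum.cong refl sum.swap)
  also have "\<dots> = inner (A ** transpose C) B"
    by (simp add: inner_vec_def matrix_matrix_mult_def transpose_def sum_distrib_left sum_distrib_right mult_ac)
  finally show ?thesis .
qed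

lemma inner_transpose: "inner (transpose A) (transpose B) = inner (A::real^'q^'p) B"
  unfolding inner_vec_def transpose_def by (simp, rule sum.swap)

text \<open>Transposition is an isometry that reverses products, so this adjoint reduces to the
  previous one.\<close>

lemma inner_matrix_mult_right:
  "inner (A::real^'k^'p) (B ** C) = inner (transpose B ** A) (C::real^'k^'q)"
proof -
  have "inner A (B ** C) = inner (transpose A) (transpose C ** transpose B)"
    by (simp add: inner_transpose flip: matrix_transpose_mul)
  also have "\<dots> = inner (transpose (transpose B ** A)) (transpose C)"
    by (simp add: inner_matrix_mult_left matrix_transpose_mul)
  also have "\<dots> = inner (transpose B ** A) C"
    by (rule inner_transpose)
  finally show ?thesis .
qed

lemma inner_hadamard: "inner (A::real^'q^'p) (B \<circ>\<^sub>H C) = inner (B \<circ>\<^sub>H A) C"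
  by (simp add: inner_vec_def hadamard_def mult_ac)

lemma matrix_mult_minus_left: "(- A) ** B = - (A ** (B::real^'k^'q))" for A :: "real^'q^'p"
  by (rule bounded_bilinear.minus_left[OF bounded_bilinear_matrix_matrix_mult])

lemma matrix_mult_minus_right: "A ** (- B) = - (A ** (B::real^'k^'q))" for A :: "real^'q^'p"
  by (rule bounded_bilinear.minus_right[OF bounded_bilinear_matrix_matrix_mult])

lemma hadamard_minus_right: "A \<circ>\<^sub>H (- B) = - (A \<circ>\<^sub>H B)"
  by (rule bounded_bilinear.minus_right[OF bounded_bilinear_hadamard])

lemma hadamard_add_right: "A \<circ>\<^sub>H (B + C) = A \<circ>\<^sub>H B + A \<circ>\<^sub>H C"
  by (rule bounded_bilinear.add_right[OF bounded_bilinear_hadamard])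

lemma hadamard_zero_right [simp]: "A \<circ>\<^sub>H 0 = 0"
  by (rule bounded_bilinear.zero_right[OF bounded_bilinear_hadamard])

lemma bounded_linear_weight1: "bounded_linear weight1"
  unfolding linear_conv_bounded_linear[symmetric]
  by (rule linearI) (simp_all add: weight1_def vec_eq_iff)

lemma bounded_linear_weight0: "bounded_linear weight0"
  unfolding linear_conv_bounded_linear[symmetric]
  by (rule linearI) (simp_all add: weight0_def vec_eq_iff)

text \<open>Linearity is joint in the two blocks, hence the form on pairs;
  \<open>has_derivative_Pair\<close> then gives the rule for two separate functions.\<close>

lemma bounded_linear_vec_of_weights: "bounded_linear (\<lambda>p. vec_of_weights (fst p) (snd p))"
  unfolding linear_conv_bounded_linear[symmetric]
  by (rule linearI) (simp_all add: vec_of_weights_def vec_eq_iff split: sum.split)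

lemmas has_derivative_weight [derivative_intros] =
  bounded_linear.has_derivative[OF bounded_linear_weight1]
  bounded_linear.has_derivative[OF bounded_linear_weight0]

lemma has_derivative_vec_of_weights [derivative_intros]:
  assumes "(f has_derivative f') (at x within T)" "(g has_derivative g') (at x within T)"
  shows "((\<lambda>x. vec_of_weights (f x) (g x)) has_derivative (\<lambda>h. vec_of_weights (f' h) (g' h))) (at x within T)"
  using bounded_linear.has_derivative[OF bounded_linear_vec_of_weights has_derivative_Pair[OF assms]]
  by simp

text \<open>The coordinates form a disjoint sum, so the inner product splits by blocks. A functional
  on weight vectors is thereby represented by one matrix per block.\<close>

lemma inner_vec_of_weights: "inner (vec_of_weights A B) v = inner A (weight1 v) + inner B (weight0 v)"
proof -
  have "inner (vec_of_weights A B) v = (\<Sum>c \<in> UNIV <+> UNIV. vec_of_weights A B $ c * v $ c)"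
    by (simp add: inner_vec_def)
  also have "\<dots> = (\<Sum>(i, k)\<in>UNIV. A $ i $ k * weight1 v $ i $ k) + (\<Sum>(k, l)\<in>UNIV. B $ k $ l * weight0 v $ k $ l)"
    by (subst sum.Plus) (simp_all add: vec_of_weights_def weight1_def weight0_def case_prod_unfold)
  also have "\<dots> = inner A (weight1 v) + inner B (weight0 v)"
    by (simp add: inner_vec_def sum.cartesian_product)
  finally show ?thesis .
qed

lemma vec_of_weights_eq_0_iff: "vec_of_weights A B = 0 \<longleftrightarrow> A = 0 \<and> B = 0"
  unfolding vec_eq_iff vec_of_weights_def
  by (auto simp: split_sum_all)

text \<open>Basis vectors have the form \<open>axis i u\<close>, so pairing with one factors through
  component \<open>i\<close>. This allows components that are themselves vectors, such as matrix
  rows.\<close>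

lemma has_derivative_vec_componentwise:
  fixes f :: "'a::real_normed_vector \<Rightarrow> ('b::euclidean_space)^'n"
  assumes "\<And>i. ((\<lambda>x. f x $ i) has_derivative (\<lambda>h. f' h $ i)) (at x within S)"
  shows "(f has_derivative f') (at x within S)"
proof (subst has_derivative_componentwise_within, intro ballI)
  fix b :: "'b^'n" assume "b \<in> Basis"
  then obtain i u where "b = axis i u"
    by (auto simp: Basis_vec_def)
  then show "((\<lambda>x. f x \<bullet> b) has_derivative (\<lambda>h. f' h \<bullet> b)) (at x within S)"
    using bounded_linear.has_derivative[OF bounded_linear_inner_left assms[of i], of u]
    by (simp add: inner_axis)
qed

text \<open>Each output entry depends only on the same input entry, so the scalar chain rule acts
  entry by entry and its factors assemble into a Hadamard product.\<close>

lemma has_derivative_map_matrix: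
  fixes f :: "'a::real_normed_vector \<Rightarrow> real^'q^'p"
  assumes f: "(f has_derivative f') (at x within T)"
    and \<sigma>: "\<And>t. \<sigma> differentiable (at t)"
  shows "((\<lambda>x. map_matrix \<sigma> (f x)) has_derivative (\<lambda>h. map_matrix (deriv \<sigma>) (f x) \<circ>\<^sub>H f' h)) (at x within T)"
proof (intro has_derivative_vec_componentwise)
  fix i j
  have fij: "((\<lambda>x. f x $ i $ j) has_derivative (\<lambda>h. f' h $ i $ j)) (at x within T)"
    using bounded_linear.has_derivative[OF bounded_linear_vec_nth
        bounded_linear.has_derivative[OF bounded_linear_vec_nth f]] .
  have "(\<sigma> has_field_derivative deriv \<sigma> (f x $ i $ j)) (at (f x $ i $ j))"
    using \<sigma> by (simp add: DERIV_deriv_iff_real_differentiable)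
  from has_derivative_compose[OF fij this[unfolded has_field_derivative_def]]
  show "((\<lambda>x. map_matrix \<sigma> (f x) $ i $ j) has_derivative
      (\<lambda>h. (map_matrix (deriv \<sigma>) (f x) \<circ>\<^sub>H f' h) $ i $ j)) (at x within T)"
    by (simp add: map_matrix_def hadamard_def)
qed

text \<open>Uniqueness of the Frechet derivative identifies it with \<open>inner G\<close>, whose
  values on the axes are the coordinates of \<open>G\<close>.\<close>

lemma gradient_eqI:
  assumes "(f has_derivative (\<lambda>h. inner G h)) (at x)"
  shows "gradient f x = G"
  by (simp add: gradient_def vec_eq_iff frechet_derivative_at[OF assms, symmetric] inner_axis)

text \<open>The Hessian is the matrix of the linear map \<open>H\<close>, so its action on a
  direction is found without computing second partial derivatives.\<close>

lemma hessian_vector_mult: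
  assumes "(gradient f has_derivative H) (at x)"
  shows "hessian f x *v v = H v"
  using matrix_works[of H v] has_derivative_linear[OF assms]
  by (simp add: hessian_def jacobian_def frechet_derivative_at[OF assms, symmetric])

lemma gradient_loss_vec:
  fixes X :: "real^'d^'n" and Y :: "real^'d^'m"
    and v :: "real^(('m::finite \<times> 'r::finite) + ('r \<times> 'n::finite))"
  assumes \<sigma>: "\<And>t. \<sigma> differentiable (at t)"
  defines "S \<equiv> map_matrix \<sigma> (weight0 v ** X)"
    and "S' \<equiv> map_matrix (deriv \<sigma>) (weight0 v ** X)"
  defines "R \<equiv> Y - weight1 v ** S"
  shows "gradient (loss_vec \<sigma> X Y) v = vec_of_weights (- (R ** transpose S))
    (- ((S' \<circ>\<^sub>H (transpose (weight1 v) ** R)) ** transpose X))"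
    (is "_ = ?G")
proof (rule gradient_eqI)
  have WX: "((\<lambda>v. weight0 v ** X) has_derivative (\<lambda>h. weight0 h ** X)) (at v)"
    by (rule has_derivative_eq_rhs, (rule derivative_intros)+) simp
  note S = has_derivative_map_matrix[OF WX \<sigma>, folded S'_def]
  have R: "((\<lambda>v. Y - weight1 v ** map_matrix \<sigma> (weight0 v ** X)) has_derivative
      (\<lambda>h. - (weight1 v ** (S' \<circ>\<^sub>H (weight0 h ** X)) + weight1 h ** S))) (at v)"
    by (rule has_derivative_eq_rhs, (rule S derivative_intros)+) (simp add: S_def)
  have "(loss_vec \<sigma> X Y has_derivative
      (\<lambda>h. inner R (- (weight1 v ** (S' \<circ>\<^sub>H (weight0 h ** X)) + weight1 h ** S)))) (at v)"
    unfolding loss_vec_def loss_def power2_norm_eq_inner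
    by (rule has_derivative_eq_rhs, (rule R derivative_intros)+) (simp add: R_def S_def inner_commute)
  \<comment> \<open>The adjoints move every factor other than \<open>weight1 h\<close> and
    \<open>weight0 h\<close> to the left argument. The instantiations pin each rule to the product
    it must open.\<close>
  also have "(\<lambda>h. inner R (- (weight1 v ** (S' \<circ>\<^sub>H (weight0 h ** X)) + weight1 h ** S))) = inner ?G"
    by (simp add: inner_vec_of_weights inner_diff_right fun_eq_iff
        inner_matrix_mult_left[of _ "weight1 _" S] inner_matrix_mult_left[of _ "weight0 _" X]
        inner_matrix_mult_right[of _ "weight1 v"] inner_hadamard)
  finally show "(loss_vec \<sigma> X Y has_derivative inner ?G) (at v)" .
qed

text \<open>The gradient formula holds at all weights, so it can be differentiated as a function of
  \<open>v\<close>. The second derivative of \<open>\<sigma>\<close> enters only through the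
  derivative of \<open>S'\<close>, which is paired with the zero residual.\<close>

lemma hessian_loss_vec_zero_residual:
  fixes X :: "real^'d^'n" and Y :: "real^'d^'m"
    and v h :: "real^(('m::finite \<times> 'r::finite) + ('r \<times> 'n::finite))"
  assumes \<sigma>: "\<And>t. \<sigma> differentiable (at t)" and \<sigma>': "\<And>t. deriv \<sigma> differentiable (at t)"
  defines "S \<equiv> map_matrix \<sigma> (weight0 v ** X)"
    and "S' \<equiv> map_matrix (deriv \<sigma>) (weight0 v ** X)"
  defines "D \<equiv> \<lambda>h. weight1 h ** S + weight1 v ** (S' \<circ>\<^sub>H (weight0 h ** X))"
  assumes Y: "Y = weight1 v ** S"
  shows "hessian (loss_vec \<sigma> X Y) v *v h = vec_of_weights (D h ** transpose S)
    ((S' \<circ>\<^sub>H (transpose (weight1 v) ** D h)) ** transpose X)"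
proof (rule hessian_vector_mult)
  have WX: "((\<lambda>v. weight0 v ** X) has_derivative (\<lambda>h. weight0 h ** X)) (at v)"
    by (rule has_derivative_eq_rhs, (rule derivative_intros)+) simp
  note S = has_derivative_map_matrix[OF WX \<sigma>, folded S'_def]
    and S' = has_derivative_map_matrix[OF WX \<sigma>']
  have R: "((\<lambda>v. Y - weight1 v ** map_matrix \<sigma> (weight0 v ** X)) has_derivative (\<lambda>h. - D h)) (at v)"
    by (rule has_derivative_eq_rhs, (rule S derivative_intros)+) (simp add: S_def D_def add_ac)
  \<comment> \<open>Rewriting with this deletes the product-rule terms in which \<open>S\<close>,
    \<open>S'\<close> or the transpose of \<open>weight1 v\<close> is differentiated.\<close>
  have R0: "Y - weight1 v ** map_matrix \<sigma> (weight0 v ** X) = 0"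
    using Y by (simp add: S_def)
  show "(gradient (loss_vec \<sigma> X Y) has_derivative (\<lambda>h. vec_of_weights (D h ** transpose S)
      ((S' \<circ>\<^sub>H (transpose (weight1 v) ** D h)) ** transpose X))) (at v)"
    unfolding gradient_loss_vec[OF \<sigma>, abs_def]
    by (rule has_derivative_eq_rhs, (rule R S S' derivative_intros)+)
      (simp add: R0 S_def S'_def fun_eq_iff matrix_mult_minus_left matrix_mult_minus_right hadamard_minus_right)
qed

theorem theorem2:
  fixes X :: "real^'d^'n" and Y :: "real^'d^'m" and \<sigma> :: "real \<Rightarrow> real"
    and W1 :: "real^'r^'m" and W0 :: "real^'n^'r"
  defines "S \<equiv> map_matrix \<sigma> (W0 ** X)"
    and "S' \<equiv> map_matrix (deriv \<sigma>) (W0 ** X)"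
    and "N \<equiv> nullspace (hessian (loss_vec \<sigma> X Y) (vec_of_weights W1 W0))"
  assumes "\<And>t. \<sigma> differentiable (at t)"
    and "\<And>t. deriv \<sigma> differentiable (at t)"
    and "Y = W1 ** map_matrix \<sigma> (W0 ** X)"
    and "full_rank W1"
    and "rank (map_matrix \<sigma> (W0 ** X)) = CARD('r)"
  shows "(\<forall>V1 V0. vec_of_weights V1 V0 \<in> N \<longleftrightarrow>
            (V1 ** S + W1 ** (S' \<circ>\<^sub>H (V0 ** X))) \<bottom>\<^sub>M transpose S \<and>
            ((S' \<circ>\<^sub>H (transpose W1 ** V1 ** S))
              + (S' \<circ>\<^sub>H (transpose W1 ** W1 ** (S' \<circ>\<^sub>H (V0 ** X))))) \<bottom>\<^sub>M transpose X) \<and>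
         (\<forall>V0. S' \<circ>\<^sub>H (V0 ** X) = 0 \<longrightarrow>
            vec_of_weights
              (- (W1 ** (S' \<circ>\<^sub>H (V0 ** X)) ** transpose S ** matrix_inv (S ** transpose S))) V0 \<in> N)"
proof -
  let ?D = "\<lambda>V1 V0. V1 ** S + W1 ** (S' \<circ>\<^sub>H (V0 ** X))"
  have mem: "vec_of_weights V1 V0 \<in> N \<longleftrightarrow>
      ?D V1 V0 ** transpose S = 0 \<and> (S' \<circ>\<^sub>H (transpose W1 ** ?D V1 V0)) ** transpose X = 0" for V1 V0
    using assms(6) unfolding N_def nullspace_def
    by (simp add: hessian_loss_vec_zero_residual[OF assms(4,5)] vec_of_weights_eq_0_iff S_def S'_def)
  \<comment> \<open>Linearity of the Hadamard product in its right argument puts the same factor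
    \<open>S'\<close> on both summands.\<close>
  have split: "(S' \<circ>\<^sub>H (transpose W1 ** ?D V1 V0)) =
      (S' \<circ>\<^sub>H (transpose W1 ** V1 ** S)) + (S' \<circ>\<^sub>H (transpose W1 ** W1 ** (S' \<circ>\<^sub>H (V0 ** X))))" for V1 V0
    by (simp add: matrix_add_ldistrib matrix_mul_assoc hadamard_add_right)
  have char: "vec_of_weights V1 V0 \<in> N \<longleftrightarrow> ?D V1 V0 \<bottom>\<^sub>M transpose S \<and>
      ((S' \<circ>\<^sub>H (transpose W1 ** V1 ** S))
        + (S' \<circ>\<^sub>H (transpose W1 ** W1 ** (S' \<circ>\<^sub>H (V0 ** X))))) \<bottom>\<^sub>M transpose X" for V1 V0
    by (simp add: mem split rows_perp_cols_iff)
  moreover have "vec_of_weights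
      (- (W1 ** (S' \<circ>\<^sub>H (V0 ** X)) ** transpose S ** matrix_inv (S ** transpose S))) V0 \<in> N"
    if "S' \<circ>\<^sub>H (V0 ** X) = 0" for V0
    \<comment> \<open>The premise turns the prescribed first block into 0, so \<open>?D\<close>
      vanishes and with it both blocks of the Hessian image.\<close>
    using that by (simp add: mem)
  ultimately show ?thesis by blast
qed

end
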